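(* Let $M$ be a (non-empty) manifold of dimension at least $1$. Then $(\mathrm{Ran}(M),\tau_{\mathrm{fin}})$, stratified by the cardinality map $\mathrm{card}\colon\mathrm{Ran}(M)\to\mathbb{N}_{\ge1}$, is not conically stratified.
   Context: $\mathrm{Ran}(M)$ is the set of non-empty finite subsets of $M$. For $n\ge1$ let $\pi_n\colon M^n\to\mathrm{Ran}(M)$ send a tuple to its set of coordinates. The final topology $\tau_{\mathrm{fin}}$ on $\mathrm{Ran}(M)$ is the finest topology making all $\pi_n$ continuous. Stratified spaces. A poset $P$ carries the Alexandrov topology, whose open sets are the upward closed subsets. A space stratified over $P$ is a topological space $T$ with a continuous map $\varphi\colon T\to P$. The poset $\mathbb{N}_{\ge1}$ has its usual order, and $\mathrm{card}$ is a stratification of $(\mathrm{Ran}(M),\tau_{\mathrm{fin}})$. Cone. For a stratified space $\varphi\colon L\to P$, the cone $c(L)$ is the set $L\times[0,1)/(L\times\{0\})$ with the teardrop topology, having as basis the sets $\pi(U)$ for $U$ open in $L\times(0,1)$ and the sets $\pi(L\times[0,\epsilon))$ for $0<\epsilon<1$, where $\pi\colon L\times[0,1)\to c(L)$ is the quotient map (the cone on the empty space is a point). It is stratified over $P\cup\{-\infty\}$, $-\infty$ a new least element, by $c(\varphi)([(x,t)])=\varphi(x)$ if $t>0$ and $-\infty$ if $t=0$. Conically stratified. For $p\in P$ write $P_{>p}=\{q\in P\mid q>p\}$, $P_{\ge p}=\{q\in P\mid q\ge p\}$, and identify $P_{>p}\cup\{-\infty\}$ with $P_{\ge p}$ by $-\infty\mapsto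 p$. A stratified space $\varphi\colon T\to P$ is conically stratified if for every $x\in T$, with $p=\varphi(x)$, there exist a neighborhood $U\subset T$ of $x$, an open neighborhood $E$ of $x$ in $\varphi^{-1}(p)$, a stratified space $\varphi_L\colon L\to P_{>p}$, and a homeomorphism $h\colon E\times c(L)\to U$ such that $\varphi(h(e,z))=c(\varphi_L)(z)$ for all $(e,z)\in E\times c(L)$. *)

theory Defs
  imports "HOL-Analysis.Analysis"
begin

section \<open>Manifolds\<close>

definition manifold_of_dim :: "nat \<Rightarrow> 'a topology \<Rightarrow> bool" where
  "manifold_of_dim n M \<longleftrightarrow>
     Hausdorff_space M \<and> second_countable M \<and>
     (\<forall>x\<in>topspace M. \<exists>U V. openin M U \<and> x \<in> U \<and> openin (Euclidean_space n) V \<and>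
        subtopology M U homeomorphic_space subtopology (Euclidean_space n) V)"

section \<open>The Ran space with the final topology\<close>

definition Ran :: "'a topology \<Rightarrow> 'a set set" where
  "Ran M = {S. S \<noteq> {} \<and> finite S \<and> S \<subseteq> topspace M}"

text \<open>The power \<open>M\<^sup>n\<close>; its points are the functions on \<open>{..<n}\<close> (extended by
  \<open>undefined\<close>) with values in \<open>M\<close>.\<close>

definition power_top :: "'a topology \<Rightarrow> nat \<Rightarrow> (nat \<Rightarrow> 'a) topology" where
  "power_top M n = product_topology (\<lambda>_. M) {..<n}"

definition coord_set :: "nat \<Rightarrow> (nat \<Rightarrow> 'a) \<Rightarrow> 'a set" where
  "coord_set n f = f ` {..<n}"

definition Ran_fin :: "'a topology \<Rightarrow> 'a set topology" where
  "Ran_fin M = topology (\<lambda>U. U \<subseteq> Ran M \<and>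
     (\<forall>n\<ge>1. openin (power_top M n) {f \<in> topspace (power_top M n). coord_set n f \<in> U}))"

lemma openin_Ran_fin:
  "openin (Ran_fin M) U \<longleftrightarrow> U \<subseteq> Ran M \<and>
     (\<forall>n\<ge>1. openin (power_top M n) {f \<in> topspace (power_top M n). coord_set n f \<in> U})"
proof -
  let ?P = "\<lambda>n U. {f \<in> topspace (power_top M n). coord_set n f \<in> U}"
  have "?P n (S \<inter> T) = ?P n S \<inter> ?P n T" for n S T by auto
  moreover have "?P n (\<Union>K) = \<Union> (?P n ` K)" for n K by auto
  ultimately have "istopology (\<lambda>U. U \<subseteq> Ran M \<and> (\<forall>n\<ge>1. openin (power_top M n) (?P n U)))"
    unfolding istopology_def by (auto intro!: openin_Int openin_Union)
  then show ?thesis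
    unfolding Ran_fin_def by (simp add: topology_inverse')
qed

lemma coord_set_in_Ran:
  assumes "n \<ge> 1" "f \<in> topspace (power_top M n)"
  shows "coord_set n f \<in> Ran M"
  using assms by (auto simp: Ran_def coord_set_def power_top_def PiE_iff lessThan_empty_iff)

lemma topspace_Ran_fin: "topspace (Ran_fin M) = Ran M"
proof -
  have "{f \<in> topspace (power_top M n). coord_set n f \<in> Ran M} = topspace (power_top M n)"
    if "n \<ge> 1" for n
    using coord_set_in_Ran that by blast
  then have "openin (Ran_fin M) (Ran M)"
    by (simp add: openin_Ran_fin)
  then show ?thesis
    by (meson openin_Ran_fin openin_subset openin_topspace subset_antisym)
qed

lemma continuous_map_coord_set:
  assumes "n \<ge> 1"
  shows "continuous_map (power_top M n) (Ran_fin M) (coord_set n)"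
  using assms coord_set_in_Ran[OF assms]
  by (auto simp: continuous_map_def topspace_Ran_fin openin_Ran_fin)

lemma Ran_fin_finest:
  assumes "topspace T = Ran M"
    and "\<And>n. n \<ge> 1 \<Longrightarrow> continuous_map (power_top M n) T (coord_set n)"
    and "openin T U"
  shows "openin (Ran_fin M) U"
  using assms openin_subset[OF assms(3)]
  by (auto simp: openin_Ran_fin continuous_map_def)

section \<open>Stratified spaces\<close>

definition alexandrov :: "'p::order set \<Rightarrow> 'p topology" where
  "alexandrov P = topology (\<lambda>U. U \<subseteq> P \<and> (\<forall>p\<in>U. \<forall>q\<in>P. p \<le> q \<longrightarrow> q \<in> U))"

lemma openin_alexandrov:
  "openin (alexandrov P) U \<longleftrightarrow> U \<subseteq> P \<and> (\<forall>p\<in>U. \<forall>q\<in>P. p \<le> q \<longrightarrow> q \<in> U)"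
proof -
  have "istopology (\<lambda>U. U \<subseteq> P \<and> (\<forall>p\<in>U. \<forall>q\<in>P. p \<le> q \<longrightarrow> q \<in> U))"
    unfolding istopology_def by (safe; blast)
  then show ?thesis
    unfolding alexandrov_def by (simp add: topology_inverse')
qed

lemma topspace_alexandrov: "topspace (alexandrov P) = P"
proof -
  have "openin (alexandrov P) P" by (auto simp: openin_alexandrov)
  then show ?thesis
    by (meson openin_alexandrov openin_subset openin_topspace subset_antisym)
qed

definition stratified_over :: "'a topology \<Rightarrow> 'p::order set \<Rightarrow> ('a \<Rightarrow> 'p) \<Rightarrow> bool" where
  "stratified_over T P \<phi> \<longleftrightarrow> continuous_map T (alexandrov P) \<phi>"

lemma stratified_over_card:
  assumes "Hausdorff_space M"
  shows "stratified_over (Ran_fin M) {1..} card"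
proof -
  have "openin (power_top M n) {f \<in> topspace (power_top M n). k \<le> card (coord_set n f)}"
    (is "openin _ ?S") for n k
  proof (subst openin_subopen, safe)
    fix f assume f: "f \<in> topspace (power_top M n)" and k: "k \<le> card (coord_set n f)"
    obtain I where I: "I \<subseteq> {..<n}" "inj_on f I" "f ` I = coord_set n f"
      unfolding coord_set_def by (metis subset_image_inj order_refl)
    have fin: "finite I" using I(1) finite_subset by blast
    define W where "W i j = {g \<in> topspace (power_top M n). g i \<noteq> g j}" for i j
    have W: "openin (power_top M n) (W i j)" if "i < n" "j < n" for i j
    proof -
      have "continuous_map (power_top M n) (prod_topology M M) (\<lambda>g. (g i, g j))"
        unfolding power_top_def using that
        by (intro continuous_map_pairedI continuous_map_product_projection) auto
      moreover have "openin (prod_topology M M)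
          (topspace (prod_topology M M) - ((\<lambda>x. (x, x)) ` topspace M))"
        using assms unfolding Hausdorff_space_closedin_diagonal by (rule openin_diff[OF openin_topspace])
      ultimately have "openin (power_top M n) {g \<in> topspace (power_top M n).
          (g i, g j) \<in> topspace (prod_topology M M) - ((\<lambda>x. (x, x)) ` topspace M)}"
        by (rule openin_continuous_map_preimage)
      also have "\<dots> = W i j"
        using that by (auto simp: W_def power_top_def PiE_iff)
      finally show ?thesis .
    qed
    define T where "T = topspace (power_top M n) \<inter> (\<Inter>(i,j)\<in>{(i,j). i \<in> I \<and> j \<in> I \<and> i \<noteq> j}. W i j)"
    have "{(i,j). i \<in> I \<and> j \<in> I \<and> i \<noteq> j} \<subseteq> I \<times> I" by auto
    then have fin2: "finite {(i,j). i \<in> I \<and> j \<in> I \<and> i \<noteq> j}"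
      using fin finite_subset by blast
    have "openin (power_top M n) T"
      unfolding T_def using I(1) W by (intro openin_Int_Inter) (auto simp: fin2)
    moreover have "f \<in> T"
      using f I(2) by (auto simp: T_def W_def inj_on_def)
    moreover have "T \<subseteq> ?S"
    proof safe
      fix g assume g: "g \<in> T"
      then show "g \<in> topspace (power_top M n)" by (simp add: T_def)
      have "inj_on g I" using g by (fastforce simp: T_def W_def inj_on_def)
      then have "card I = card (g ` I)" by (simp add: card_image)
      also have "\<dots> \<le> card (coord_set n g)"
        unfolding coord_set_def using I(1) by (intro card_mono) auto
      finally show "k \<le> card (coord_set n g)"
        using k I by (metis card_image order_trans)
    qed
    ultimately show "\<exists>T. openin (power_top M n) T \<and> f \<in> T \<and> T \<subseteq> ?S" by blast
  qed
  then have *: "openin (Ran_fin M) {S \<in> Ran M. k \<le> card S}" for k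
    using coord_set_in_Ran[of _ _ M]
    by (simp add: openin_Ran_fin conj_left_commute cong: conj_cong)
  show ?thesis
    unfolding stratified_over_def continuous_map_def topspace_Ran_fin topspace_alexandrov
  proof (intro conjI allI impI funcsetI)
    fix S assume "S \<in> Ran M"
    then show "card S \<in> {1..}" by (simp add: Ran_def card_gt_0_iff Suc_le_eq)
  next
    fix U :: "nat set" assume U: "openin (alexandrov {1..}) U"
    show "openin (Ran_fin M) {S \<in> Ran M. card S \<in> U}"
    proof (subst openin_subopen, safe)
      fix S assume "S \<in> Ran M" "card S \<in> U"
      moreover have "m \<in> U" if "card S \<le> m" for m
        using U \<open>card S \<in> U\<close> that unfolding openin_alexandrov
        by (meson atLeast_iff order_trans subset_iff)
      ultimately have "S \<in> {S' \<in> Ran M. card S \<le> card S'}"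
        "{S' \<in> Ran M. card S \<le> card S'} \<subseteq> {S \<in> Ran M. card S \<in> U}"
        by auto
      then show "\<exists>T. openin (Ran_fin M) T \<and> S \<in> T \<and> T \<subseteq> {S \<in> Ran M. card S \<in> U}"
        using *[of "card S"] by blast
    qed
  qed
qed

section \<open>Cones\<close>

text \<open>The quotient of \<open>L \<times> [0,1)\<close> by \<open>L \<times> {0}\<close> is modelled in \<open>('l \<times> real) option\<close>: \<open>None\<close> is
  the cone point and \<open>Some (x, t)\<close> with \<open>0 < t\<close> is the class of \<open>(x, t)\<close>.\<close>

definition cone_proj :: "'l \<times> real \<Rightarrow> ('l \<times> real) option" where
  "cone_proj z = (if snd z = 0 then None else Some z)"

text \<open>The cone point is inserted explicitly because for empty \<open>L\<close> it is not in the image of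
  \<^const>\<open>cone_proj\<close>; for nonempty \<open>L\<close> the insertion changes nothing.\<close>

definition cone_base :: "'l topology \<Rightarrow> ('l \<times> real) option set set" where
  "cone_base L =
     {cone_proj ` U | U. openin (prod_topology L (top_of_set {0<..<1})) U} \<union>
     {insert None (cone_proj ` (topspace L \<times> {0..<\<epsilon>})) | \<epsilon>. 0 < \<epsilon> \<and> \<epsilon> < 1}"

definition cone :: "'l topology \<Rightarrow> ('l \<times> real) option topology" where
  "cone L = topology (arbitrary union_of (\<lambda>B. B \<in> cone_base L))"

lemma cone_base_Int:
  assumes "A \<in> cone_base L" "B \<in> cone_base L"
  shows "A \<inter> B \<in> cone_base L"
proof -
  let ?X = "prod_topology L (top_of_set {0<..<1::real})"
  let ?N = "\<lambda>\<epsilon>. insert None (cone_proj ` (topspace L \<times> {0..<\<epsilon>}))"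
  have sub: "U \<subseteq> topspace L \<times> {0<..<1}" if "openin ?X U" for U
    using openin_subset[OF that] by simp
  have eq: "cone_proj ` U = Some ` U" if "openin ?X U" for U
    using sub[OF that] by (force simp: cone_proj_def image_iff)
  have N: "?N \<epsilon> = insert None (Some ` (topspace L \<times> {0<..<\<epsilon>}))" if "0 < \<epsilon>" for \<epsilon>
    using that by (force simp: cone_proj_def image_iff)
  have 1: "cone_proj ` U \<inter> cone_proj ` V \<in> cone_base L" if "openin ?X U" "openin ?X V" for U V
  proof -
    have "openin ?X (U \<inter> V)" using that by blast
    moreover have "cone_proj ` U \<inter> cone_proj ` V = cone_proj ` (U \<inter> V)"
      by (simp add: eq that openin_Int) blast
    ultimately show ?thesis unfolding cone_base_def by blast
  qed
  have 2: "cone_proj ` U \<inter> ?N \<epsilon> \<in> cone_base L" if U: "openin ?X U" and e: "0 < \<epsilon>" "\<epsilon> < 1" for U \<epsilon>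
  proof -
    have "openin (top_of_set {0<..<1}) {0<..<\<epsilon>}"
      unfolding openin_open using e by (intro exI[of _ "{0<..<\<epsilon>}"]) auto
    then have "openin ?X (topspace L \<times> {0<..<\<epsilon>})"
      by (simp add: openin_prod_Times_iff)
    then have "openin ?X (U \<inter> topspace L \<times> {0<..<\<epsilon>})" using U by blast
    moreover have "cone_proj ` U \<inter> ?N \<epsilon> = cone_proj ` (U \<inter> topspace L \<times> {0<..<\<epsilon>})"
      unfolding N[OF e(1)] eq[OF U] eq[OF calculation] by blast
    ultimately show ?thesis unfolding cone_base_def by blast
  qed
  have 3: "?N \<delta> \<inter> ?N \<epsilon> \<in> cone_base L" if e: "0 < \<delta>" "\<delta> < 1" "0 < \<epsilon>" "\<epsilon> < 1" for \<delta> \<epsilon>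
  proof -
    have m: "0 < min \<delta> \<epsilon>" using e by simp
    have "?N \<delta> \<inter> ?N \<epsilon> = ?N (min \<delta> \<epsilon>)"
      unfolding N[OF e(1)] N[OF e(3)] N[OF m] by auto
    moreover have "0 < min \<delta> \<epsilon>" "min \<delta> \<epsilon> < 1" using e by auto
    ultimately show ?thesis unfolding cone_base_def by blast
  qed
  have cases: "(\<exists>U. openin ?X U \<and> C = cone_proj ` U) \<or> (\<exists>\<epsilon>. 0 < \<epsilon> \<and> \<epsilon> < 1 \<and> C = ?N \<epsilon>)"
    if "C \<in> cone_base L" for C
    using that unfolding cone_base_def by blast
  show ?thesis
    using cases[OF assms(1)] cases[OF assms(2)]
  proof (elim disjE exE conjE)
    fix \<epsilon> U assume "0 < \<epsilon>" "\<epsilon> < 1" "A = ?N \<epsilon>" "openin ?X U" "B = cone_proj ` U"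
    then show ?thesis using 2[of U \<epsilon>] by (metis Int_commute)
  qed (use 1 2 3 in \<open>blast+\<close>)
qed

lemma openin_cone:
  "openin (cone L) = arbitrary union_of (\<lambda>B. B \<in> cone_base L)"
  unfolding cone_def by (intro topology_inverse' istopology_base cone_base_Int)

text \<open>Here \<open>'p option\<close> stands for \<open>P \<union> {-\<infinity>}\<close>, with \<open>None\<close> as \<open>-\<infinity>\<close>.\<close>

definition cone_strat :: "('l \<Rightarrow> 'p) \<Rightarrow> ('l \<times> real) option \<Rightarrow> 'p option" where
  "cone_strat \<phi> = map_option (\<lambda>(x, t). \<phi> x)"

text \<open>The identification of \<open>P\<^bsub>>p\<^esub> \<union> {-\<infinity>}\<close> with \<open>P\<^bsub>\<ge>p\<^esub>\<close>.\<close>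

definition adjoin_least :: "'p \<Rightarrow> 'p option \<Rightarrow> 'p" where
  "adjoin_least p = case_option p id"

section \<open>Conically stratified spaces\<close>

text \<open>A property of a space \<open>T\<close> with a stratification \<open>\<phi>\<close> over \<open>P\<close>. HOL has no existential
  quantifier over types, so the type \<open>'l\<close> carrying the links \<open>L\<close> is a parameter. A link always
  injects into \<open>T\<close> by sending \<open>y\<close> to \<open>h (x, Some (y, 1/2))\<close>, so \<open>'l = 'a\<close> already allows all links;
  the property fails in the mathematical sense iff it fails for every \<open>'l\<close>.\<close>

definition conically_stratified ::
    "'l itself \<Rightarrow> 'a topology \<Rightarrow> 'p::order set \<Rightarrow> ('a \<Rightarrow> 'p) \<Rightarrow> bool" where
  "conically_stratified (_ :: 'l itself) T P \<phi> \<longleftrightarrow>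
     (\<forall>x\<in>topspace T. \<exists>U E (L :: 'l topology) \<phi>\<^sub>L h.
        U \<subseteq> topspace T \<and> (\<exists>V. openin T V \<and> x \<in> V \<and> V \<subseteq> U) \<and>
        openin (subtopology T {y \<in> topspace T. \<phi> y = \<phi> x}) E \<and> x \<in> E \<and>
        stratified_over L {q \<in> P. \<phi> x < q} \<phi>\<^sub>L \<and>
        homeomorphic_map (prod_topology (subtopology T E) (cone L)) (subtopology T U) h \<and>
        (\<forall>e\<in>E. \<forall>z\<in>topspace (cone L). \<phi> (h (e, z)) = adjoin_least (\<phi> x) (cone_strat \<phi>\<^sub>L z)))"

end

theory Submission
  imports Defs
begin

text \<open>
  A family of finite sets with only finitely many members of each cardinality is closed in the
  final topology: \<open>M\<^sup>n\<close> only sees members with at most \<open>n\<close> points, and each of them has only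
  finitely many preimages there (\<open>closedin_Ran_fin_locally_finite_card\<close>). Hence finite sets
  \<open>S\<^sub>k\<close> whose cardinality tends to infinity never converge to a singleton \<open>{m}\<close>, however
  closely they cluster around \<open>m\<close>.

  A conical chart at \<open>{m}\<close> would produce such a convergent sequence. Since \<open>m\<close> is not isolated,
  every neighborhood of \<open>{m}\<close> contains sets of arbitrarily large cardinality
  (\<open>neighborhood_singleton_large_card\<close>), so the link \<open>L\<close> has points \<open>l\<^sub>k\<close> in strata of
  arbitrarily large index. In the teardrop topology the distance to the apex is measured uniformly
  over the link (\<open>openin_cone_apex\<close>), so the cone points \<open>(l\<^sub>k, 1/(k+2))\<close> converge to the apex
  whatever the \<open>l\<^sub>k\<close> are. As the chart preserves strata, it takes the apex over a suitable point of
  \<open>E\<close> to \<open>{m}\<close>, and it takes the cone points over the same point of \<open>E\<close> to sets \<open>S\<^sub>k\<close> of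
  unbounded cardinality that converge to \<open>{m}\<close>.
\<close>

lemma not_openin_Euclidean_space_singleton:
  assumes "n \<ge> 1"
  shows "\<not> openin (Euclidean_space n) {p}"
proof
  assume op: "openin (Euclidean_space n) {p}"
  then have p: "p \<in> topspace (Euclidean_space n)"
    using openin_subset by blast
  \<comment> \<open>The line through \<open>p\<close> parallel to the first coordinate axis.\<close>
  define c where "c = (\<lambda>t::real. p(0 := t))"
  have "continuous_map euclideanreal (Euclidean_space n) c"
    unfolding Euclidean_space_def continuous_map_in_subtopology
  proof
    show "continuous_map euclideanreal (powertop_real UNIV) c"
      unfolding continuous_map_componentwise_UNIV c_def by simp
    show "c \<in> topspace euclideanreal \<rightarrow> {x. \<forall>i\<ge>n. x i = 0}"
      using p assms by (auto simp: c_def topspace_Euclidean_space)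
  qed
  then have "openin euclideanreal {t \<in> topspace euclideanreal. c t \<in> {p}}"
    using op by (rule openin_continuous_map_preimage)
  also have "{t \<in> topspace euclideanreal. c t \<in> {p}} = {p 0}"
    by (auto simp: c_def fun_eq_iff split: if_splits)
  finally show False
    using not_open_singleton[of "p 0"] by (simp flip: open_openin)
qed

text \<open>In a T1 space a point of a finite open set is isolated, and a chart would carry an isolated
  point to an isolated point of \<open>\<real>\<^sup>n\<close>.\<close>

lemma manifold_nonempty_open_infinite:
  assumes M: "manifold_of_dim n M" and "n \<ge> 1" and W: "openin M W" "m \<in> W"
  shows "infinite W"
proof
  assume "finite W"
  have mM: "m \<in> topspace M" using W openin_subset by blast
  have "t1_space M"
    using M by (simp add: manifold_of_dim_def Hausdorff_imp_t1_space)
  moreover have "W - {m} \<subseteq> topspace M" "finite (W - {m})"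
    using W openin_subset \<open>finite W\<close> by auto
  ultimately have "closedin M (W - {m})"
    using t1_space_closedin_finite by blast
  moreover have "W - (W - {m}) = {m}" using W by auto
  ultimately have m: "openin M {m}"
    using openin_diff[OF W(1)] by metis
  obtain U V f where U: "openin M U" "m \<in> U" and V: "openin (Euclidean_space n) V"
    and f: "homeomorphic_map (subtopology M U) (subtopology (Euclidean_space n) V) f"
    using M mM unfolding manifold_of_dim_def homeomorphic_space by metis
  have "openin (subtopology M U) {m}"
    using m U by (simp add: openin_open_subtopology)
  then have "openin (subtopology (Euclidean_space n) V) (f ` {m})"
    using f by (meson homeomorphic_imp_open_map open_map_def)
  then have "openin (Euclidean_space n) {f m}"
    using V by (simp add: openin_open_subtopology)
  then show False
    using not_openin_Euclidean_space_singleton[OF \<open>n \<ge> 1\<close>] by blast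
qed

text \<open>A neighborhood of \<open>{m}\<close> pulls back to a neighborhood of the diagonal point \<open>(m, \<dots>, m)\<close> of
  \<open>M\<^sup>n\<close>, hence contains the image of \<open>W\<^sup>n\<close> for a neighborhood \<open>W\<close> of \<open>m\<close>; as \<open>W\<close> is infinite,
  \<open>W\<^sup>n\<close> contains injective tuples.\<close>

lemma neighborhood_singleton_large_card:
  assumes inf: "\<And>W. openin M W \<Longrightarrow> m \<in> W \<Longrightarrow> infinite W"
    and V: "openin (Ran_fin M) V" "{m} \<in> V" and "n \<ge> 1"
  shows "\<exists>S\<in>V. card S = n"
proof -
  let ?P = "{f \<in> topspace (power_top M n). coord_set n f \<in> V}"
  let ?c = "\<lambda>i\<in>{..<n}. m"
  have mM: "m \<in> topspace M"
    using V openin_subset[OF V(1)] by (auto simp: topspace_Ran_fin Ran_def)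
  have P: "openin (product_topology (\<lambda>_. M) {..<n}) ?P"
    using V \<open>n \<ge> 1\<close> by (simp add: openin_Ran_fin power_top_def)
  have "coord_set n ?c = {m}"
    using \<open>n \<ge> 1\<close> image_constant[of 0 "{..<n}" m] by (simp add: coord_set_def)
  then have "?c \<in> ?P"
    using V mM by (simp add: power_top_def)
  then obtain B where "\<forall>i\<in>{..<n}. openin M (B i)"
    and B: "?c \<in> Pi\<^sub>E {..<n} B" "Pi\<^sub>E {..<n} B \<subseteq> ?P"
    using P unfolding openin_product_topology_alt by blast
  then have B_open: "openin M (B i)" if "i < n" for i using that by simp
  define W where "W = topspace M \<inter> (\<Inter>i<n. B i)"
  have "openin M W" "m \<in> W"
    unfolding W_def using B B_open mM by (auto intro!: openin_Int_Inter simp: PiE_iff)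
  then have "infinite W" by (rule inf)
  then obtain S where S: "S \<subseteq> W" "finite S" "card S = n"
    by (meson infinite_arbitrarily_large)
  obtain g where g: "bij_betw g {..<n} S"
    using S by (metis card_lessThan finite_lessThan finite_same_card_bij)
  have img: "coord_set n (restrict g {..<n}) = S"
    using g by (simp add: coord_set_def bij_betw_def)
  have "g i \<in> B i" if "i < n" for i
    using that g S(1) by (auto simp: W_def bij_betw_def)
  then have "restrict g {..<n} \<in> Pi\<^sub>E {..<n} B" by auto
  then have "coord_set n (restrict g {..<n}) \<in> V" using B(2) by blast
  then have "S \<in> V" by (simp only: img)
  then show ?thesis using S by blast
qed

text \<open>This is where the final topology enters: closedness is tested in each \<open>M\<^sup>n\<close> separately, and
  there the preimage of \<open>A\<close> is a finite set.\<close>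

lemma closedin_Ran_fin_locally_finite_card:
  fixes M :: "'a topology"
  assumes M: "t1_space M" and A: "A \<subseteq> Ran M" and fin: "\<And>n. finite {S \<in> A. card S \<le> n}"
  shows "closedin (Ran_fin M) A"
proof -
  have "openin (power_top M n) {f \<in> topspace (power_top M n). coord_set n f \<in> Ran M - A}"
    if n: "n \<ge> 1" for n
  proof -
    let ?F = "{f \<in> topspace (power_top M n). coord_set n f \<in> A}"
    have "card (coord_set n f) \<le> n" for f :: "nat \<Rightarrow> 'a"
      unfolding coord_set_def using card_image_le[of "{..<n}" f] by simp
    moreover have "f i \<in> coord_set n f" if "i < n" for f :: "nat \<Rightarrow> 'a" and i
      using that by (simp add: coord_set_def)
    ultimately have "?F \<subseteq> Pi\<^sub>E {..<n} (\<lambda>_. \<Union>{S \<in> A. card S \<le> n})"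
      unfolding power_top_def topspace_product_topology PiE_iff subset_iff by blast
    moreover have "finite (\<Union>{S \<in> A. card S \<le> n})"
      using fin A by (auto simp: Ran_def)
    ultimately have "finite ?F"
      by (meson finite_PiE finite_lessThan finite_subset)
    moreover have "t1_space (power_top M n)"
      using M by (simp add: power_top_def t1_space_product_topology)
    ultimately have "closedin (power_top M n) ?F"
      by (auto simp: t1_space_closedin_finite)
    then have "openin (power_top M n) (topspace (power_top M n) - ?F)"
      by blast
    also have "topspace (power_top M n) - ?F =
        {f \<in> topspace (power_top M n). coord_set n f \<in> Ran M - A}"
      using coord_set_in_Ran[OF n] by blast
    finally show ?thesis .
  qed
  then show ?thesis
    using A by (simp add: closedin_def topspace_Ran_fin openin_Ran_fin)
qed

lemma topspace_cone: "topspace (cone L) = insert None (Some ` (topspace L \<times> {0<..<1}))"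
proof
  have "B \<subseteq> insert None (Some ` (topspace L \<times> {0<..<1}))" if "B \<in> cone_base L" for B
  proof -
    have "U \<subseteq> topspace L \<times> {0<..<1}"
      if "openin (prod_topology L (top_of_set {0<..<1::real})) U" for U
      using openin_subset[OF that] by simp
    then show ?thesis
      using that unfolding cone_base_def cone_proj_def by fastforce
  qed
  moreover have "(arbitrary union_of (\<lambda>B. B \<in> cone_base L)) (topspace (cone L))"
    by (simp flip: openin_cone)
  ultimately show "topspace (cone L) \<subseteq> insert None (Some ` (topspace L \<times> {0<..<1}))"
    unfolding union_of_def by blast
next
  have base: "openin (cone L) B" if "B \<in> cone_base L" for B
    using that by (simp add: openin_cone arbitrary_union_of_inc)
  have "insert None (cone_proj ` (topspace L \<times> {0..<1/2})) \<in> cone_base L"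
    unfolding cone_base_def by (intro UnI2 CollectI exI[of _ "1/2"]) auto
  then have "None \<in> topspace (cone L)"
    using openin_subset[OF base] by blast
  moreover have "cone_proj ` (topspace L \<times> {0<..<1}) \<in> cone_base L"
    unfolding cone_base_def
    by (intro UnI1 CollectI exI[of _ "topspace L \<times> {0<..<1}"])
      (auto simp: openin_prod_Times_iff)
  then have "cone_proj ` (topspace L \<times> {0<..<1}) \<subseteq> topspace (cone L)"
    using openin_subset[OF base] by blast
  then have "Some ` (topspace L \<times> {0<..<1}) \<subseteq> topspace (cone L)"
    by (force simp: cone_proj_def)
  ultimately show "insert None (Some ` (topspace L \<times> {0<..<1})) \<subseteq> topspace (cone L)"
    by blast
qed

text \<open>The characteristic property of the teardrop topology. The quotient topology would only
  give an \<open>\<epsilon>\<close> depending on \<open>l\<close>.\<close>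

lemma openin_cone_apex:
  assumes "openin (cone L) B" "None \<in> B"
  obtains \<epsilon> where "\<epsilon> > 0" "\<And>l t. l \<in> topspace L \<Longrightarrow> 0 < t \<Longrightarrow> t < \<epsilon> \<Longrightarrow> Some (l, t) \<in> B"
proof -
  obtain C where C: "C \<in> cone_base L" "None \<in> C" "C \<subseteq> B"
    using assms unfolding openin_cone union_of_def by auto
  have "None \<notin> cone_proj ` U" if "openin (prod_topology L (top_of_set {0<..<1::real})) U" for U
    using openin_subset[OF that] by (fastforce simp: cone_proj_def split: if_splits)
  then obtain \<epsilon> where \<epsilon>: "\<epsilon> > 0" "C = insert None (cone_proj ` (topspace L \<times> {0..<\<epsilon>}))"
    using C unfolding cone_base_def by blast
  have "Some (l, t) \<in> B" if "l \<in> topspace L" "0 < t" "t < \<epsilon>" for l t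
  proof -
    have "Some (l, t) = cone_proj (l, t)" using that by (simp add: cone_proj_def)
    then show ?thesis using that C \<epsilon> by auto
  qed
  then show ?thesis using that \<epsilon> by blast
qed

theorem proposition7p40:
  fixes M :: "'a topology" and n :: nat
  assumes "manifold_of_dim n M" and "n \<ge> 1" and "topspace M \<noteq> {}"
  shows "\<not> conically_stratified TYPE('l) (Ran_fin M) {1..} card"
proof
  assume con: "conically_stratified TYPE('l) (Ran_fin M) {1..} card"
  let ?T = "Ran_fin M"
  obtain m where m: "m \<in> topspace M" using assms by blast
  have inf: "infinite W" if "openin M W" "m \<in> W" for W
    using manifold_nonempty_open_infinite assms that by metis
  have t1: "t1_space M"
    using assms by (simp add: manifold_of_dim_def Hausdorff_imp_t1_space)
  have m_in_Ran: "{m} \<in> topspace ?T" using m by (simp add: topspace_Ran_fin Ran_def)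
  obtain U E V and L :: "'l topology" and \<phi>\<^sub>L h where
    U: "U \<subseteq> topspace ?T" and V: "openin ?T V" "{m} \<in> V" "V \<subseteq> U" and
    E: "openin (subtopology ?T {y \<in> topspace ?T. card y = card {m}}) E" and
    st: "stratified_over L {q \<in> {1..}. card {m} < q} \<phi>\<^sub>L" and
    h: "homeomorphic_map (prod_topology (subtopology ?T E) (cone L)) (subtopology ?T U) h" and
    ch: "\<And>e z. e \<in> E \<Longrightarrow> z \<in> topspace (cone L) \<Longrightarrow>
           card (h (e, z)) = adjoin_least (card {m}) (cone_strat \<phi>\<^sub>L z)"
    using con[unfolded conically_stratified_def, THEN bspec, OF m_in_Ran]
    by (elim exE conjE) (rule that, assumption+, drule (1) bspec, drule (1) bspec, assumption)
  have "E \<subseteq> topspace ?T" using openin_subset[OF E] by auto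
  then have im: "h ` (E \<times> topspace (cone L)) = U"
    using homeomorphic_imp_surjective_map[OF h] U by (simp add: Int_absorb1)
  have link: "\<phi>\<^sub>L l > 1" if "l \<in> topspace L" for l
    using st that unfolding stratified_over_def continuous_map_def topspace_alexandrov by auto
  have card_None: "card (h (e, None)) = 1" if "e \<in> E" for e
    using ch[OF that, of None] by (simp add: topspace_cone cone_strat_def adjoin_least_def)
  have card_Some: "card (h (e, Some (l, t))) = \<phi>\<^sub>L l"
    if "e \<in> E" "l \<in> topspace L" "0 < t" "t < 1" for e l t
    using ch[OF that(1), of "Some (l, t)"] that
    by (simp add: topspace_cone cone_strat_def adjoin_least_def)
  \<comment> \<open>The chart need not take \<open>({m}, None)\<close> to \<open>{m}\<close>, so the preimage \<open>(e, z)\<close> of \<open>{m}\<close> is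
    taken instead; \<open>z\<close> is the apex because \<open>{m}\<close> lies in the lowest stratum.\<close>
  obtain e z where ez: "e \<in> E" "z \<in> topspace (cone L)" "h (e, z) = {m}"
    using im V by blast
  have "z = None"
  proof (rule ccontr)
    assume "z \<noteq> None"
    then obtain l t where "z = Some (l, t)" "l \<in> topspace L" "0 < t" "t < 1"
      using ez by (auto simp: topspace_cone)
    then show False
      using card_Some[OF ez(1), of l t] link[of l] ez by simp
  qed
  \<comment> \<open>Sets with at least two points lie off the apex, so their cardinality is the stratum of a
    point of the link.\<close>
  have "\<exists>l\<in>topspace L. \<phi>\<^sub>L l = k + 2" for k
  proof -
    obtain S where S: "S \<in> V" "card S = k + 2"
      using neighborhood_singleton_large_card[OF inf V(1,2), of "k + 2"] by auto
    then obtain d y where dy: "d \<in> E" "y \<in> topspace (cone L)" "h (d, y) = S"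
      using im V by blast
    then have "y \<noteq> None" using card_None[OF \<open>d \<in> E\<close>] S(2) by (intro notI) simp
    then obtain l t where "y = Some (l, t)" "l \<in> topspace L" "0 < t" "t < 1"
      using dy by (auto simp: topspace_cone)
    then show ?thesis using card_Some[of d l t] dy S by auto
  qed
  then obtain l where l: "\<And>k. l k \<in> topspace L" "\<And>k. \<phi>\<^sub>L (l k) = k + 2"
    by metis
  \<comment> \<open>The offset 2 keeps \<open>r k\<close> strictly below 1.\<close>
  define r where "r k = 1 / (real k + 2)" for k
  have r: "0 < r k" "r k < 1" for k by (auto simp: r_def)
  define S where "S k = h (e, Some (l k, r k))" for k
  have card_S: "card (S k) = k + 2" for k
    unfolding S_def using card_Some[OF ez(1) l(1) r] l(2) by simp
  have S_U: "S k \<in> U" for k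
    unfolding S_def using im ez(1) l(1)[of k] r[of k] by (auto simp: topspace_cone)
  have "finite {X \<in> range S. card X \<le> j}" for j
  proof (rule finite_subset)
    show "{X \<in> range S. card X \<le> j} \<subseteq> S ` {..j}" by (auto simp: card_S)
  qed simp
  then have cl: "closedin ?T (range S)"
    using S_U U by (intro closedin_Ran_fin_locally_finite_card t1) (auto simp: topspace_Ran_fin)
  \<comment> \<open>The complement of the closed set \<open>range S\<close> pulls back to a neighborhood of the point over
    \<open>{m}\<close>, which must contain \<open>Some (l k, r k)\<close> over \<open>e\<close> for large \<open>k\<close>.\<close>
  let ?G = "{w \<in> topspace (prod_topology (subtopology ?T E) (cone L)). h w \<in> U - range S}"
  have "openin (subtopology ?T U) (U - range S)"
    unfolding openin_subtopology
    using cl U by (intro exI[of _ "topspace ?T - range S"]) auto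
  then have op: "openin (prod_topology (subtopology ?T E) (cone L)) ?G"
    using openin_continuous_map_preimage[OF homeomorphic_imp_continuous_map[OF h]] by blast
  have apex: "(e, None) \<in> ?G"
  proof -
    have "S k \<noteq> {m}" for k using card_S[of k] by auto
    then have "{m} \<notin> range S" by blast
    then show ?thesis using ez \<open>z = None\<close> \<open>E \<subseteq> topspace ?T\<close> V by auto
  qed
  obtain D B where DB: "openin (cone L) B" "e \<in> D" "None \<in> B" "D \<times> B \<subseteq> ?G"
    using openin_prod_topology_alt[THEN iffD1, OF op, rule_format, OF apex]
    by (elim exE conjE) (rule that)
  obtain \<epsilon> where \<epsilon>: "\<epsilon> > 0" "\<And>l t. l \<in> topspace L \<Longrightarrow> 0 < t \<Longrightarrow> t < \<epsilon> \<Longrightarrow> Some (l, t) \<in> B"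
    using openin_cone_apex[OF DB(1,3)] by blast
  obtain k where "inverse (real (Suc k)) < \<epsilon>" using reals_Archimedean \<epsilon>(1) by blast
  moreover have "r k \<le> inverse (real (Suc k))"
    by (simp add: r_def field_simps)
  ultimately have "r k < \<epsilon>" by simp
  then have "Some (l k, r k) \<in> B" using \<epsilon>(2) l(1) r(1) by blast
  then have "(e, Some (l k, r k)) \<in> ?G" using DB(2,4) by blast
  then have "S k \<notin> range S" unfolding S_def[of k] by simp
  then show False by simp
qed

end
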